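(* Let $G$ be a chordal graph. If $M_G$ is a mixed graph with underlying graph $G$ in which each mixed triangle belongs to $\mathcal{C}_3=\{K_3,K_3^{2,2},K_3^{2,3}\}$, then $M_G\in[G]$, i.e., $M_G$ is switching equivalent to $G$.
   Context: A mixed graph $M=(V,E,A)$ has a finite vertex set $V$, a set $E$ of undirected edges ($u\leftrightarrow v$) and a set $A$ of arcs ($u\to v$); there are no loops, and any two distinct vertices are joined by at most one of: an undirected edge, the arc $u\to v$, the arc $v\to u$. The underlying graph is the simple graph on $V$ obtained by forgetting directions; $M_G$ denotes a mixed graph with underlying graph $G$, and a simple graph is regarded as a mixed graph with $A=\emptyset$. The Hermitian matrix $H(M)=[h_{st}]$ has $h_{st}=1$ if $v_s\leftrightarrow v_t$, $h_{st}=i$ if $v_s\to v_t$, $h_{st}=-i$ if $v_t\to v_s$, and $0$ otherwise. Two mixed graphs $M,M'$ with the same underlying graph are switching equivalent if $H(M')=DH(M)D^*$ for some diagonal matrix $D$ with diagonal entries in $\{\pm1,\pm i\}$; $[M]$ is the switching equivalence class of $M$. A chordal graph is one in which every cycle of length at least four has a chord. A mixed triangle in $M$ is the mixed subgraph induced by three pairwise adjacent vertices; membership in $\mathcal{C}_3$ is up to isomorphism. $K_3$: all three edges undirected. $K_3^{2,2}$: vertices $u,v,w$ with $u\to w$, $v\to w$, $u\leftrightarrow v$. $K_3^{2,3}$: vertices $u,v,w$ with $w\to u$, $w\to v$, $u\leftrightarrow v$. *)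

theory Defs
  imports Complex_Main "Jordan_Normal_Form.Schur_Decomposition"
begin

record 'a mixed_graph =
  verts :: "'a set"
  edges :: "'a set set"
  arcs :: "('a \<times> 'a) set"

text \<open>An undirected edge \<open>u \<leftrightarrow> v\<close> is the two-element set \<open>{u, v}\<close> in \<open>edges\<close>; an arc
  \<open>u \<rightarrow> v\<close> is the pair \<open>(u, v)\<close> in \<open>arcs\<close>.\<close>

definition wf_mixed_graph :: "'a mixed_graph \<Rightarrow> bool" where
  "wf_mixed_graph M \<longleftrightarrow>
     finite (verts M) \<and>
     (\<forall>e\<in>edges M. e \<subseteq> verts M \<and> card e = 2) \<and>
     arcs M \<subseteq> verts M \<times> verts M \<and>
     (\<forall>(u, v)\<in>arcs M. u \<noteq> v \<and> (v, u) \<notin> arcs M \<and> {u, v} \<notin> edges M)"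

definition simple_graph :: "'a mixed_graph \<Rightarrow> bool" where
  "simple_graph G \<longleftrightarrow> wf_mixed_graph G \<and> arcs G = {}"

definition underlying_graph :: "'a mixed_graph \<Rightarrow> 'a mixed_graph" where
  "underlying_graph M =
     \<lparr>verts = verts M, edges = edges M \<union> {{u, v} |u v. (u, v) \<in> arcs M}, arcs = {}\<rparr>"

text \<open>A cycle is given by its cyclic sequence of vertices; its length is the length of the list.\<close>

definition cycle_edges :: "'a list \<Rightarrow> 'a set set" where
  "cycle_edges c = {{c ! k, c ! (Suc k mod length c)} |k. k < length c}"

definition is_cycle :: "'a mixed_graph \<Rightarrow> 'a list \<Rightarrow> bool" where
  "is_cycle G c \<longleftrightarrow> 3 \<le> length c \<and> distinct c \<and> cycle_edges c \<subseteq> edges G"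

definition is_chord :: "'a mixed_graph \<Rightarrow> 'a list \<Rightarrow> 'a set \<Rightarrow> bool" where
  "is_chord G c e \<longleftrightarrow> e \<in> edges G \<and> e \<subseteq> set c \<and> e \<notin> cycle_edges c"

definition chordal_graph :: "'a mixed_graph \<Rightarrow> bool" where
  "chordal_graph G \<longleftrightarrow>
     simple_graph G \<and> (\<forall>c. is_cycle G c \<and> 4 \<le> length c \<longrightarrow> (\<exists>e. is_chord G c e))"

definition induced_subgraph :: "'a mixed_graph \<Rightarrow> 'a set \<Rightarrow> 'a mixed_graph" where
  "induced_subgraph M S =
     \<lparr>verts = S, edges = {e \<in> edges M. e \<subseteq> S}, arcs = arcs M \<inter> S \<times> S\<rparr>"

definition mixed_triangles :: "'a mixed_graph \<Rightarrow> 'a mixed_graph set" where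
  "mixed_triangles M =
     {induced_subgraph M S |S. S \<subseteq> verts M \<and> card S = 3 \<and>
        (\<forall>u\<in>S. \<forall>v\<in>S. u \<noteq> v \<longrightarrow> {u, v} \<in> edges (underlying_graph M))}"

definition mixed_graph_iso :: "'a mixed_graph \<Rightarrow> 'b mixed_graph \<Rightarrow> bool" where
  "mixed_graph_iso M N \<longleftrightarrow>
     (\<exists>f. bij_betw f (verts M) (verts N) \<and>
          (\<lambda>e. f ` e) ` edges M = edges N \<and> map_prod f f ` arcs M = arcs N)"

text \<open>The three reference triangles, with \<open>u = 0\<close>, \<open>v = 1\<close>, \<open>w = 2\<close>.\<close>

definition K3 :: "nat mixed_graph" where
  "K3 = \<lparr>verts = {0, 1, 2}, edges = {{0, 1}, {0, 2}, {1, 2}}, arcs = {}\<rparr>"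

definition K3_22 :: "nat mixed_graph" where
  "K3_22 = \<lparr>verts = {0, 1, 2}, edges = {{0, 1}}, arcs = {(0, 2), (1, 2)}\<rparr>"

definition K3_23 :: "nat mixed_graph" where
  "K3_23 = \<lparr>verts = {0, 1, 2}, edges = {{0, 1}}, arcs = {(2, 0), (2, 1)}\<rparr>"

definition C3 :: "nat mixed_graph set" where
  "C3 = {K3, K3_22, K3_23}"

definition hermitian_entry :: "'a mixed_graph \<Rightarrow> 'a \<Rightarrow> 'a \<Rightarrow> complex" where
  "hermitian_entry M u v =
     (if {u, v} \<in> edges M then 1
      else if (u, v) \<in> arcs M then \<i>
      else if (v, u) \<in> arcs M then - \<i>
      else 0)"

text \<open>The list \<open>vs\<close> is a labelling \<open>v\<^sub>0, \<dots>, v\<^sub>n\<^sub>-\<^sub>1\<close> of the vertices.\<close>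

definition vertex_labelling :: "'a mixed_graph \<Rightarrow> 'a list \<Rightarrow> bool" where
  "vertex_labelling M vs \<longleftrightarrow> distinct vs \<and> set vs = verts M"

definition hermitian_matrix :: "'a list \<Rightarrow> 'a mixed_graph \<Rightarrow> complex mat" where
  "hermitian_matrix vs M =
     mat (length vs) (length vs) (\<lambda>(s, t). hermitian_entry M (vs ! s) (vs ! t))"

definition switching_matrix :: "nat \<Rightarrow> complex mat \<Rightarrow> bool" where
  "switching_matrix n D \<longleftrightarrow>
     D \<in> carrier_mat n n \<and> diagonal_mat D \<and> (\<forall>k<n. D $$ (k, k) \<in> {1, - 1, \<i>, - \<i>})"

text \<open>Both Hermitian matrices are taken with respect to the same labelling of the common vertex
  set. Relabelling conjugates \<open>H(M)\<close>, \<open>H(M')\<close> and \<open>D\<close> by one permutation matrix, so the choice of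
  the labelling is irrelevant; a labelling exists because the vertex set is finite.\<close>

definition switching_equivalent :: "'a mixed_graph \<Rightarrow> 'a mixed_graph \<Rightarrow> bool" where
  "switching_equivalent M M' \<longleftrightarrow>
     wf_mixed_graph M \<and> wf_mixed_graph M' \<and> underlying_graph M = underlying_graph M' \<and>
     (\<forall>vs. vertex_labelling M vs \<longrightarrow>
        (\<exists>D. switching_matrix (length vs) D \<and>
             hermitian_matrix vs M' = D * hermitian_matrix vs M * mat_adjoint D))"

definition switching_class :: "'a mixed_graph \<Rightarrow> 'a mixed_graph set" where
  "switching_class M = {M'. switching_equivalent M M'}"

end

theory Submission
  imports Defs
begin

text \<open>Read \<open>H(M)\<close> as a gain function: traversing an edge from \<open>u\<close> to \<open>v\<close> contributes the entry
  \<open>h\<^sub>u\<^sub>v\<close>, a fourth root of unity, and traversing it backwards contributes the inverse. The gain of a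
  walk is the product of its entries. The hypothesis on the triangles says exactly that every
  triangle, traversed in either direction, has gain one.

  In a chordal graph this propagates to all closed walks, by induction on the length
  (\<open>chordal_balanced\<close>): a closed walk with a repeated vertex splits there into two shorter closed
  walks, while one without repetition and of length at least four is a cycle, which a chord cuts
  into two shorter cycles. The chord is traversed once in each direction, so the product of the
  gains of the two parts is the gain of the original walk.

  If every closed walk has gain one, the gain of a walk depends only on its end points, so there is
  a potential \<open>p\<close>, with fourth roots of unity as values, such that \<open>p u * h\<^sub>u\<^sub>v = p v\<close> on every
  edge (\<open>balanced_imp_potential\<close>). As \<open>p u\<close> has modulus one, \<open>h\<^sub>u\<^sub>v\<close> is the product of the
  conjugate of \<open>p u\<close> with \<open>p v\<close>. Hence the diagonal matrix with the conjugates of the values of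
  \<open>p\<close> switches \<open>G\<close> to \<open>M\<close> (\<open>hermitian_matrix_diagonal_switch\<close>).\<close>

section \<open>Gains along walks\<close>

fun walk_gain :: "('a \<Rightarrow> 'a \<Rightarrow> 'b::comm_monoid_mult) \<Rightarrow> 'a list \<Rightarrow> 'b" where
  "walk_gain g [] = 1"
| "walk_gain g [x] = 1"
| "walk_gain g (x # y # zs) = g x y * walk_gain g (y # zs)"

lemma walk_gain_split:
  "walk_gain g (xs @ y # ys) = walk_gain g (xs @ [y]) * walk_gain g (y # ys)"
  by (induction xs rule: induct_list012) (auto simp: mult.assoc)

lemma walk_gain_closed_set:
  assumes "successively adj xs" "1 \<in> U"
    and "\<And>u v. adj u v \<Longrightarrow> g u v \<in> U"
    and "\<And>a b. a \<in> U \<Longrightarrow> b \<in> U \<Longrightarrow> a * b \<in> U"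
  shows "walk_gain g xs \<in> U"
  using assms(1) by (induction xs rule: induct_list012) (auto intro: assms(2-))

definition walk :: "('a \<Rightarrow> 'a \<Rightarrow> bool) \<Rightarrow> 'a \<Rightarrow> 'a list \<Rightarrow> 'a \<Rightarrow> bool" where
  "walk adj u xs v \<longleftrightarrow> xs \<noteq> [] \<and> hd xs = u \<and> last xs = v \<and> successively adj xs"

lemma walk_append_iff:
  "walk adj u (xs @ v # ys) w \<longleftrightarrow> walk adj u (xs @ [v]) v \<and> walk adj v (v # ys) w"
  by (cases "xs = []") (auto simp: walk_def successively_append_iff)

lemma walk_concat:
  assumes "walk adj u xs v" "walk adj v ys w"
  obtains zs where "walk adj u zs w" "\<And>g. walk_gain g zs = walk_gain g xs * walk_gain g ys"
proof -
  obtain xs' where xs: "xs = xs' @ [v]"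
    using assms(1) by (metis append_butlast_last_id walk_def)
  obtain ys' where ys: "ys = v # ys'"
    using assms(2) by (metis list.collapse walk_def)
  show thesis
  proof (rule that)
    show "walk adj u (xs' @ v # ys') w"
      using assms unfolding xs ys by (subst walk_append_iff) simp
    show "\<And>g. walk_gain g (xs' @ v # ys') = walk_gain g xs * walk_gain g ys"
      unfolding xs ys by (rule walk_gain_split)
  qed
qed

lemma walk_edge: "adj u v \<Longrightarrow> walk adj u [u, v] v"
  by (simp add: walk_def)

lemma rtranclp_imp_walk: "adj\<^sup>*\<^sup>* u v \<Longrightarrow> \<exists>xs. walk adj u xs v"
proof (induction rule: rtranclp_induct)
  case base
  have "walk adj u [u] u" by (simp add: walk_def)
  then show ?case ..
next
  case (step v w)
  then show ?case by (meson walk_concat walk_edge)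
qed

text \<open>The potential of a vertex is the gain of a walk to it from a chosen root of its connected
  component. Two walks with the same end points have the same gain, because one and the same walk
  back to the root closes both of them; this is how the cancellation works without division. That
  each value is itself a walk gain carries multiplicatively closed properties over from the edges
  to the potential.\<close>

lemma balanced_imp_potential:
  fixes g :: "'a \<Rightarrow> 'a \<Rightarrow> 'b::comm_monoid_mult"
  assumes sym: "symp adj"
    and balanced: "\<And>u xs. walk adj u xs u \<Longrightarrow> walk_gain g xs = 1"
  obtains p where "\<And>u v. adj u v \<Longrightarrow> p u * g u v = p v"
    and "\<And>v. \<exists>xs. successively adj xs \<and> p v = walk_gain g xs"
proof -
  have symr: "adj\<^sup>*\<^sup>* v u" if "adj\<^sup>*\<^sup>* u v" for u v
    using that sym by (metis sympD symp_rtranclp)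
  define root where "root v = (SOME r. adj\<^sup>*\<^sup>* r v)" for v
  have root: "adj\<^sup>*\<^sup>* (root v) v" for v
    unfolding root_def by (rule someI[of _ v]) simp
  have root_eq: "root u = root v" if "adj u v" for u v
  proof -
    have "adj\<^sup>*\<^sup>* r u \<longleftrightarrow> adj\<^sup>*\<^sup>* r v" for r
      using that sym by (meson rtranclp.rtrancl_into_rtrancl sympD)
    then show ?thesis by (simp add: root_def)
  qed
  define path where "path v = (SOME xs. walk adj (root v) xs v)" for v
  have path: "walk adj (root v) (path v) v" for v
    unfolding path_def by (rule someI_ex) (rule rtranclp_imp_walk[OF root])
  show thesis
  proof (rule that[of "\<lambda>v. walk_gain g (path v)"])
    fix u v assume uv: "adj u v"
    obtain ret where ret: "walk adj v ret (root v)"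
      using rtranclp_imp_walk[OF symr[OF root]] by blast
    obtain zs where "walk adj (root u) zs v"
      "walk_gain g zs = walk_gain g (path u) * walk_gain g [u, v]"
      using walk_concat[OF path walk_edge[of adj, OF uv]] by blast
    then have zs: "walk adj (root v) zs v" "walk_gain g zs = walk_gain g (path u) * g u v"
      using root_eq[OF uv] by simp_all
    have cancel: "walk_gain g ys * walk_gain g ret = 1" if "walk adj (root v) ys v" for ys
      using walk_concat[OF that ret] balanced by metis
    have "walk_gain g zs = walk_gain g zs * (walk_gain g (path v) * walk_gain g ret)"
      using cancel[OF path] by simp
    also have "\<dots> = walk_gain g (path v) * (walk_gain g zs * walk_gain g ret)"
      by (simp only: ac_simps)
    also have "\<dots> = walk_gain g (path v)"
      using cancel[OF zs(1)] by simp
    finally show "walk_gain g (path u) * g u v = walk_gain g (path v)"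
      unfolding zs(2) .
  next
    show "\<exists>xs. successively adj xs \<and> walk_gain g (path v) = walk_gain g xs" for v
      using path[of v] unfolding walk_def by blast
  qed
qed

section \<open>Closed walks in chordal graphs\<close>

definition adjacent :: "'a mixed_graph \<Rightarrow> 'a \<Rightarrow> 'a \<Rightarrow> bool" where
  "adjacent G u v \<longleftrightarrow> {u, v} \<in> edges G"

lemma symp_adjacent: "symp (adjacent G)"
  by (auto simp: symp_def adjacent_def insert_commute)

lemma simple_graph_adjacent_neq: "simple_graph G \<Longrightarrow> adjacent G u v \<Longrightarrow> u \<noteq> v"
  by (auto simp: simple_graph_def wf_mixed_graph_def adjacent_def)

lemma closed_walk_is_cycle:
  assumes "walk (adjacent G) u (c @ [u]) u" "distinct c" "3 \<le> length c"
  shows "is_cycle G c"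
proof -
  have u: "u = c ! 0"
    using assms(1,3) by (cases c) (auto simp: walk_def)
  have "{c ! k, c ! (Suc k mod length c)} \<in> edges G" if "k < length c" for k
  proof -
    have "adjacent G ((c @ [u]) ! k) ((c @ [u]) ! Suc k)"
      using assms(1) that unfolding walk_def successively_conv_nth by auto
    moreover have "(c @ [u]) ! Suc k = c ! (Suc k mod length c)"
      using that u by (cases "Suc k = length c") (auto simp: nth_append)
    ultimately show ?thesis
      using that by (auto simp: adjacent_def nth_append)
  qed
  then show ?thesis
    using assms(2,3) by (auto simp: is_cycle_def cycle_edges_def)
qed

text \<open>The two conditions on nonempty parts are what a chord being outside the cycle means for the list: its end
  points are neither consecutive nor the first and the last vertex. They make both parts into which
  the chord cuts the cycle strictly shorter.\<close>

lemma chord_decomposition: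
  assumes "simple_graph G" "distinct c" "is_chord G c e"
  obtains as u bs v ds where "c = as @ u # bs @ v # ds" "adjacent G u v"
    "bs \<noteq> []" "as \<noteq> [] \<or> ds \<noteq> []"
proof -
  have e: "e \<in> edges G" "e \<subseteq> set c" "e \<notin> cycle_edges c"
    using assms(3) by (auto simp: is_chord_def)
  have "card e = 2"
    using e(1) assms(1) by (auto simp: simple_graph_def wf_mixed_graph_def)
  then obtain x y where xy: "e = {x, y}" "x \<noteq> y"
    by (auto simp: card_2_iff)
  have "\<exists>as u bs v ds. c = as @ u # bs @ v # ds \<and> e = {u, v}"
  proof -
    obtain as r where r: "c = as @ x # r"
      using e(2) xy split_list[of x c] by auto
    consider "y \<in> set as" | "y \<in> set r"
      using e(2) xy r by auto
    then show ?thesis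
    proof cases
      case 1
      then obtain a b where "as = a @ y # b" by (meson split_list)
      then have "c = a @ y # b @ x # r \<and> e = {y, x}" using r xy by auto
      then show ?thesis by blast
    next
      case 2
      then obtain a b where "r = a @ y # b" by (meson split_list)
      then have "c = as @ x # a @ y # b \<and> e = {x, y}" using r xy by auto
      then show ?thesis by blast
    qed
  qed
  then obtain as u bs v ds where c: "c = as @ u # bs @ v # ds" and uv: "e = {u, v}"
    by blast
  (* Otherwise e would be the cycle edge that starts at u. *)
  have "bs \<noteq> []"
  proof
    assume "bs = []"
    then have "length as < length c" "e = {c ! length as, c ! (Suc (length as) mod length c)}"
      using c uv by (auto simp: nth_append)
    then show False using e(3) unfolding cycle_edges_def by blast
  qed
  (* Otherwise e would be the cycle edge that wraps around from the last vertex v to u. *)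
  moreover have "as \<noteq> [] \<or> ds \<noteq> []"
  proof (rule ccontr)
    assume "\<not> ?thesis"
    then have "Suc (length bs) < length c"
      "e = {c ! Suc (length bs), c ! (Suc (Suc (length bs)) mod length c)}"
      using c uv by (auto simp: nth_append)
    then show False using e(3) unfolding cycle_edges_def by blast
  qed
  ultimately show thesis
    using that c uv e(1) by (auto simp: adjacent_def)
qed

text \<open>The closed walks form the right class for the induction: they are stable under cutting at a
  repeated vertex as well as at a chord. Closed walks with at most three edges are the base of the
  induction, where the hypotheses on edges and triangles enter.\<close>

lemma chordal_balanced:
  fixes g :: "'a \<Rightarrow> 'a \<Rightarrow> 'b::comm_monoid_mult"
  assumes chordal: "chordal_graph G"
    and inverse: "\<And>u v. adjacent G u v \<Longrightarrow> g u v * g v u = 1"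
    and triangle: "\<And>x y z. adjacent G x y \<Longrightarrow> adjacent G y z \<Longrightarrow> adjacent G z x \<Longrightarrow>
      g x y * (g y z * g z x) = 1"
    and "walk (adjacent G) w xs w"
  shows "walk_gain g xs = 1"
  using assms(4)
proof (induction "length xs" arbitrary: w xs rule: less_induct)
  case less
  have simple: "simple_graph G"
    using chordal by (simp add: chordal_graph_def)
  obtain c where c: "xs = c @ [w]"
    using less.prems by (metis append_butlast_last_id walk_def)
  consider "length c \<le> 3" | "4 \<le> length c" "\<not> distinct c" | "4 \<le> length c" "distinct c"
    by linarith
  then show ?case
  proof cases
    case 1
    then consider "c = []" | x where "c = [x]" | x y where "c = [x, y]" | x y z where "c = [x, y, z]"
      by (cases c; cases "tl c"; cases "tl (tl c)"; cases "tl (tl (tl c))") auto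
    then show ?thesis
    proof cases
      case 1
      then show ?thesis by (simp add: c)
    next
      case 2
      then show ?thesis
        using less.prems simple_graph_adjacent_neq[OF simple] by (auto simp: c walk_def)
    next
      case 3
      then show ?thesis
        using less.prems inverse by (auto simp: c walk_def)
    next
      case 4
      then show ?thesis
        using less.prems triangle by (auto simp: c walk_def)
    qed
  next
    case 2
    obtain as y bs ds where ds: "c = as @ [y] @ bs @ [y] @ ds"
      using not_distinct_decomp[OF 2(2)] by blast
    define tail where "tail = ds @ [w]"
    have xs: "xs = as @ y # bs @ y # tail"
      by (simp add: c ds tail_def)
    have walks: "walk (adjacent G) w (as @ [y]) y" "walk (adjacent G) y (y # bs @ y # tail) w"
      using walk_append_iff[of _ _ as] less.prems unfolding xs by blast+
    have walks': "walk (adjacent G) y ((y # bs) @ [y]) y" "walk (adjacent G) y (y # tail) w"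
      using walk_append_iff[of "adjacent G" y "y # bs" y tail w] walks(2) by simp_all
    have "walk_gain g ((y # bs) @ [y]) = 1"
      by (rule less.hyps[OF _ walks'(1)]) (simp add: xs tail_def)
    moreover have "walk (adjacent G) w (as @ y # tail) w"
      using walks(1) walks'(2) by (subst walk_append_iff) simp
    then have "walk_gain g (as @ y # tail) = 1"
      by (rule less.hyps[rotated]) (simp add: xs)
    ultimately show ?thesis
      unfolding xs
      using walk_gain_split[of g as y "bs @ y # tail"] walk_gain_split[of g "y # bs" y tail]
        walk_gain_split[of g as y tail] by simp
  next
    case 3
    have "is_cycle G c"
      using closed_walk_is_cycle[of G w c] less.prems 3 c by auto
    then obtain e where "is_chord G c e"
      using chordal 3(1) by (auto simp: chordal_graph_def)
    then obtain as u bs v ds where ds: "c = as @ u # bs @ v # ds" and uv: "adjacent G u v"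
      and nonempty: "bs \<noteq> []" "as \<noteq> [] \<or> ds \<noteq> []"
      using chord_decomposition[OF simple 3(2)] by metis
    have vu: "adjacent G v u"
      using uv symp_adjacent by (metis sympD)
    define tail where "tail = ds @ [w]"
    have xs: "xs = as @ u # bs @ v # tail"
      by (simp add: c ds tail_def)
    have walks: "walk (adjacent G) w (as @ [u]) u" "walk (adjacent G) u (u # bs @ v # tail) w"
      using walk_append_iff[of _ _ as] less.prems unfolding xs by blast+
    have walks': "walk (adjacent G) u ((u # bs) @ [v]) v" "walk (adjacent G) v (v # tail) w"
      using walk_append_iff[of "adjacent G" u "u # bs" v tail w] walks(2) by simp_all
    (* One part runs along the walk from u to v and returns through the chord. *)
    have "walk (adjacent G) u ((u # bs) @ v # [u]) u"
      using walks'(1) walk_edge[of "adjacent G", OF vu] by (subst walk_append_iff) simp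
    then have "walk_gain g ((u # bs) @ v # [u]) = 1"
      by (rule less.hyps[rotated]) (use nonempty in \<open>auto simp: xs tail_def\<close>)
    then have inner: "walk_gain g ((u # bs) @ [v]) * g v u = 1"
      using walk_gain_split[of g "u # bs" v "[u]"] by simp
    (* The other part takes the chord from u to v as a shortcut. *)
    have "walk (adjacent G) u ([u] @ v # tail) w"
      using walk_edge[of "adjacent G", OF uv] walks'(2) by (subst walk_append_iff) simp
    then have "walk (adjacent G) w (as @ u # v # tail) w"
      using walks(1) by (subst walk_append_iff) simp
    then have "walk_gain g (as @ u # v # tail) = 1"
      by (rule less.hyps[rotated]) (use nonempty in \<open>auto simp: xs\<close>)
    then have outer: "walk_gain g (as @ [u]) * (g u v * walk_gain g (v # tail)) = 1"
      using walk_gain_split[of g as u "v # tail"] by simp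
    have "walk_gain g xs
        = walk_gain g (as @ [u]) * (walk_gain g ((u # bs) @ [v]) * walk_gain g (v # tail))"
      unfolding xs using walk_gain_split[of g as u "bs @ v # tail"]
        walk_gain_split[of g "u # bs" v tail] by simp
    also have "\<dots> = \<dots> * (g u v * g v u)"
      using inverse[OF uv] by simp
    also have "\<dots> = (walk_gain g ((u # bs) @ [v]) * g v u)
        * (walk_gain g (as @ [u]) * (g u v * walk_gain g (v # tail)))"
      by (simp only: ac_simps)
    also have "\<dots> = 1"
      using inner outer by simp
    finally show ?thesis .
  qed
qed

section \<open>Gains of a mixed graph\<close>

lemma hermitian_entry_nonadjacent:
  "\<not> adjacent (underlying_graph M) u v \<Longrightarrow> hermitian_entry M u v = 0"
  by (auto simp: hermitian_entry_def adjacent_def underlying_graph_def insert_commute)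

lemma hermitian_entry_simple_graph:
  "simple_graph G \<Longrightarrow> hermitian_entry G u v = (if adjacent G u v then 1 else 0)"
  by (auto simp: hermitian_entry_def adjacent_def simple_graph_def)

lemma hermitian_entry_inverse:
  assumes "wf_mixed_graph M" "adjacent (underlying_graph M) u v"
  shows "hermitian_entry M u v * hermitian_entry M v u = 1"
  using assms
  by (auto simp: hermitian_entry_def adjacent_def underlying_graph_def wf_mixed_graph_def
      insert_commute doubleton_eq_iff)

text \<open>That edges and arcs of \<open>M\<close> stay inside \<open>S\<close> is needed to reflect them along \<open>f\<close>, which is
  injective on \<open>S\<close> only.\<close>

lemma hermitian_entry_iso:
  assumes M: "verts M = S" "\<forall>e\<in>edges M. e \<subseteq> S" "arcs M \<subseteq> S \<times> S"
    and f: "bij_betw f S (verts N)" "(\<lambda>e. f ` e) ` edges M = edges N"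
      "map_prod f f ` arcs M = arcs N"
    and uv: "u \<in> S" "v \<in> S"
  shows "hermitian_entry N (f u) (f v) = hermitian_entry M u v"
proof -
  have inj: "inj_on f S"
    using f(1) by (rule bij_betw_imp_inj_on)
  have edge: "{f u, f v} \<in> edges N \<longleftrightarrow> {u, v} \<in> edges M"
  proof
    assume "{f u, f v} \<in> edges N"
    then obtain e where e: "e \<in> edges M" "f ` e = f ` {u, v}"
      unfolding f(2)[symmetric] by auto
    then have "e = {u, v}"
      using inj_on_image_eq_iff[OF inj, of e "{u, v}"] M(2) uv by auto
    then show "{u, v} \<in> edges M" using e by simp
  next
    assume "{u, v} \<in> edges M"
    then have "f ` {u, v} \<in> edges N"
      unfolding f(2)[symmetric] by (rule imageI)
    then show "{f u, f v} \<in> edges N" by simp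
  qed
  have arc: "(f x, f y) \<in> arcs N \<longleftrightarrow> (x, y) \<in> arcs M" if "x \<in> S" "y \<in> S" for x y
  proof
    assume "(f x, f y) \<in> arcs N"
    then obtain a b where "(a, b) \<in> arcs M" "f a = f x" "f b = f y"
      unfolding f(3)[symmetric] by auto
    moreover from this have "a = x" "b = y"
      using inj that M(3) by (auto dest: inj_onD)
    ultimately show "(x, y) \<in> arcs M" by simp
  next
    assume "(x, y) \<in> arcs M"
    then show "(f x, f y) \<in> arcs N"
      unfolding f(3)[symmetric] by (force simp: image_iff)
  qed
  show ?thesis
    using edge arc[OF uv] arc[OF uv(2,1)] by (simp add: hermitian_entry_def)
qed

text \<open>In the two triangles with arcs, the undirected edge joins the two tails or the two heads, so
  every traversal uses one arc forwards and the other backwards, contributing \<open>\<i> * - \<i> = 1\<close>.\<close>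

lemma C3_triangle_gain:
  assumes "C \<in> C3" "a \<in> verts C" "b \<in> verts C" "c \<in> verts C" "a \<noteq> b" "b \<noteq> c" "c \<noteq> a"
  shows "hermitian_entry C a b * (hermitian_entry C b c * hermitian_entry C c a) = 1"
proof -
  have C: "C = K3 \<or> C = K3_22 \<or> C = K3_23"
    using assms(1) by (simp add: C3_def)
  then have "verts C = {0, 1, 2}"
    by (auto simp: K3_def K3_22_def K3_23_def)
  then have "(a, b, c) \<in> {(0, 1, 2), (0, 2, 1), (1, 0, 2), (1, 2, 0), (2, 0, 1), (2, 1, 0)}"
    using assms(2-) by auto
  then show ?thesis
    using C unfolding insert_iff empty_iff prod.inject
    by (elim disjE conjE FalseE)
      (simp_all add: K3_def K3_22_def K3_23_def hermitian_entry_def doubleton_eq_iff)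
qed

lemma mixed_triangle_gain:
  assumes wf: "wf_mixed_graph M"
    and triangles: "\<forall>T\<in>mixed_triangles M. \<exists>C\<in>C3. mixed_graph_iso T C"
    and adj: "adjacent (underlying_graph M) x y" "adjacent (underlying_graph M) y z"
      "adjacent (underlying_graph M) z x"
  shows "hermitian_entry M x y * (hermitian_entry M y z * hermitian_entry M z x) = 1"
proof -
  let ?S = "{x, y, z}"
  let ?T = "induced_subgraph M ?S"
  have vert: "u \<noteq> v \<and> u \<in> verts M" if "adjacent (underlying_graph M) u v" for u v
    using wf that
    by (fastforce simp: adjacent_def underlying_graph_def wf_mixed_graph_def doubleton_eq_iff)
  have distinct: "x \<noteq> y" "y \<noteq> z" "z \<noteq> x"
    using adj vert by auto
  have "?T \<in> mixed_triangles M"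
    using adj distinct vert[OF adj(1)] vert[OF adj(2)] vert[OF adj(3)]
    unfolding mixed_triangles_def adjacent_def
    by (auto simp: insert_commute intro!: exI[of _ ?S])
  then obtain C f where C: "C \<in> C3" and f: "bij_betw f ?S (verts C)"
    "(\<lambda>e. f ` e) ` edges ?T = edges C" "map_prod f f ` arcs ?T = arcs C"
    using triangles by (fastforce simp: mixed_graph_iso_def induced_subgraph_def)
  have entry: "hermitian_entry C (f u) (f v) = hermitian_entry M u v"
    if "u \<in> ?S" "v \<in> ?S" for u v
  proof -
    have "hermitian_entry C (f u) (f v) = hermitian_entry ?T u v"
      by (rule hermitian_entry_iso[OF _ _ _ f that]) (auto simp: induced_subgraph_def)
    also have "\<dots> = hermitian_entry M u v"
      using that by (auto simp: hermitian_entry_def induced_subgraph_def)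
    finally show ?thesis .
  qed
  have "f u \<in> verts C" if "u \<in> ?S" for u
    using f(1) that by (auto simp: bij_betw_def)
  moreover have "f u \<noteq> f v" if "u \<in> ?S" "v \<in> ?S" "u \<noteq> v" for u v
    using f(1) that by (meson bij_betw_imp_inj_on inj_onD)
  ultimately have "hermitian_entry C (f x) (f y)
      * (hermitian_entry C (f y) (f z) * hermitian_entry C (f z) (f x)) = 1"
    using distinct by (intro C3_triangle_gain[OF C]) auto
  then show ?thesis
    by (simp add: entry)
qed

section \<open>Switching\<close>

lemma hermitian_matrix_diagonal_switch:
  assumes "\<And>u v. hermitian_entry M' u v = d u * hermitian_entry M u v * cnj (d v)"
  defines "D \<equiv> \<lambda>vs. mat_diag (length vs) (\<lambda>k. d (vs ! k))"
  shows "hermitian_matrix vs M' = D vs * hermitian_matrix vs M * mat_adjoint (D vs)"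
proof -
  let ?n = "length vs"
  have H: "hermitian_matrix vs N \<in> carrier_mat ?n ?n" for N :: "'a mixed_graph"
    by (simp add: hermitian_matrix_def)
  have adj: "mat_adjoint (D vs) = mat_diag ?n (\<lambda>k. cnj (d (vs ! k)))"
    unfolding D_def by (rule eq_matI) (auto simp: mat_adjoint_def mat_of_rows_def mat_diag_def)
  show ?thesis
    unfolding adj unfolding D_def mat_diag_mult_left[OF H]
    by (subst mat_diag_mult_right[of _ ?n])
      (auto simp: hermitian_matrix_def assms(1) intro!: eq_matI)
qed

theorem theorem1:
  fixes G M :: "'a mixed_graph"
  assumes "chordal_graph G"
    and "wf_mixed_graph M"
    and "underlying_graph M = G"
    and "\<forall>T\<in>mixed_triangles M. \<exists>C\<in>C3. mixed_graph_iso T C"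
  shows "M \<in> switching_class G"
proof -
  let ?U = "{1, - 1, \<i>, - \<i>}"
  let ?g = "hermitian_entry M"
  have simple: "simple_graph G"
    using assms(1) by (simp add: chordal_graph_def)
  have balanced: "walk_gain ?g xs = 1" if "walk (adjacent G) u xs u" for u xs
    using assms(1) _ _ that
  proof (rule chordal_balanced)
    show "?g u v * ?g v u = 1" if "adjacent G u v" for u v
      by (rule hermitian_entry_inverse[OF assms(2)]) (simp add: assms(3) that)
    show "?g x y * (?g y z * ?g z x) = 1"
      if "adjacent G x y" "adjacent G y z" "adjacent G z x" for x y z
      by (rule mixed_triangle_gain[OF assms(2,4)]) (simp_all add: assms(3) that)
  qed
  obtain p where p: "\<And>u v. adjacent G u v \<Longrightarrow> p u * ?g u v = p v"
    and p_gain: "\<And>v. \<exists>xs. successively (adjacent G) xs \<and> p v = walk_gain ?g xs"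
    by (rule balanced_imp_potential[OF symp_adjacent, of G ?g]) (blast intro: balanced)+
  have p_unit: "p v \<in> ?U" for v
  proof -
    obtain xs where xs: "successively (adjacent G) xs" "p v = walk_gain ?g xs"
      using p_gain by blast
    have "walk_gain ?g xs \<in> ?U"
    proof (rule walk_gain_closed_set[OF xs(1)])
      show "?g u v \<in> ?U" if "adjacent G u v" for u v
      proof -
        have "?g u v \<noteq> 0"
          using that hermitian_entry_inverse[OF assms(2), of u v] assms(3) by auto
        then show ?thesis
          by (simp add: hermitian_entry_def split: if_splits)
      qed
    qed auto
    then show ?thesis using xs(2) by simp
  qed
  have p_cnj: "cnj (p v) * p v = 1" for v
    using p_unit[of v] by auto
  have entry: "?g u v = cnj (p u) * hermitian_entry G u v * cnj (cnj (p v))" for u v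
  proof (cases "adjacent G u v")
    case True
    have "?g u v = cnj (p u) * p u * ?g u v"
      by (simp add: p_cnj)
    also have "\<dots> = cnj (p u) * p v"
      using p[OF True] by (simp add: mult.assoc)
    finally show ?thesis
      using True by (simp add: hermitian_entry_simple_graph[OF simple])
  next
    case False
    then show ?thesis
      using hermitian_entry_nonadjacent[of M u v]
      by (simp add: assms(3) hermitian_entry_simple_graph[OF simple])
  qed
  have "\<exists>D. switching_matrix (length vs) D \<and>
      hermitian_matrix vs M = D * hermitian_matrix vs G * mat_adjoint D" for vs
  proof (intro exI conjI)
    let ?D = "mat_diag (length vs) (\<lambda>k. cnj (p (vs ! k)))"
    have "cnj (p v) \<in> ?U" for v
      using p_unit[of v] by auto
    then show "switching_matrix (length vs) ?D"
      by (auto simp: switching_matrix_def diagonal_mat_def mat_diag_def)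
    show "hermitian_matrix vs M = ?D * hermitian_matrix vs G * mat_adjoint ?D"
      using entry by (rule hermitian_matrix_diagonal_switch)
  qed
  moreover have "underlying_graph G = underlying_graph M"
    using assms(3) by (auto simp: underlying_graph_def)
  ultimately show ?thesis
    using simple assms(2)
    by (auto simp: switching_class_def switching_equivalent_def simple_graph_def)
qed

end
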